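(* Let $V$ be a vector space over $\mathbf{Q}$ (finite- or infinite-dimensional) with a symmetric bilinear form $(\mathbf v,\mathbf w)\mapsto \mathbf v\cdot\mathbf w$ that is an intersection product with respect to a fixed basis $E$ of $V$. For each effective element $\mathbf v\in V$, there is a unique way to write it as a sum $\mathbf v=\mathbf p+\mathbf n$ of elements $\mathbf p,\mathbf n\in V$ satisfying the following conditions: (1) $\mathbf p$ is nef with respect to $V$; (2) $\mathbf n$ is effective; (3) $\mathbf p\cdot\mathbf e=0$ for each basis element $\mathbf e\in E$ in the support of $\mathbf n$; (4) the restriction of the intersection product to the support space of $\mathbf n$ is negative definite. Furthermore, $\mathbf p$ is effective.
   Context: The form is an intersection product with respect to $E$ if $\mathbf e\cdot\mathbf e'\ge 0$ for any two distinct basis elements $\mathbf e,\mathbf e'\in E$ (self-products $\mathbf e\cdot\mathbf e$ may have any sign). Each $\mathbf v\in V$ is uniquely a linear combination, with all coefficients nonzero, of a finite subset of $E$; this finite subset is the support of $\mathbf v$, and its span is the support space of $\mathbf v$. A vector is effective if all of these coefficients are positive (equivalently, all its coordinates with respect to $E$ are nonnegative); in particular the zero vector is effective, with empty support and trivial support space. A vector $\mathbf w$ is nef with respect to $V$ if $\mathbf w\cdot\mathbf v\ge 0$ for every effective $\mathbf v\in V$. The form is negative definite on a subspace if $\mathbf x\cdot\mathbf x<0$ for every nonzero $\mathbf x$ in it (the zero subspace is vacuously negative definite). *)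

theory Defs
  imports Complex_Main
begin

text \<open>
  The vector space is a type \<open>'v\<close> of class \<open>ab_group_add\<close> together with a scalar
  multiplication satisfying \<open>vector_space scale\<close>. In the definitions below,
  \<open>E\<close> and \<open>dt\<close> are the fixed basis and the bilinear form. The notions that depend on
  coordinates are only meaningful when \<open>E\<close> is a basis, since
  \<open>module.representation\<close> is zero for dependent \<open>E\<close> and outside the span.
\<close>

definition is_basis :: "(rat \<Rightarrow> 'v \<Rightarrow> 'v::ab_group_add) \<Rightarrow> 'v set \<Rightarrow> bool" where
  "is_basis scale E \<longleftrightarrow> \<not> module.dependent scale E \<and> module.span scale E = UNIV"

definition symmetric_bilinear ::
    "(rat \<Rightarrow> 'v \<Rightarrow> 'v::ab_group_add) \<Rightarrow> ('v \<Rightarrow> 'v \<Rightarrow> rat) \<Rightarrow> bool" where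
  "symmetric_bilinear scale dt \<longleftrightarrow>
     (\<forall>v w. dt v w = dt w v) \<and>
     (\<forall>v. Vector_Spaces.linear scale (*) (dt v)) \<and>
     (\<forall>w. Vector_Spaces.linear scale (*) (\<lambda>v. dt v w))"

definition intersection_product :: "'v set \<Rightarrow> ('v \<Rightarrow> 'v \<Rightarrow> rat) \<Rightarrow> bool" where
  "intersection_product E dt \<longleftrightarrow> (\<forall>e\<in>E. \<forall>e'\<in>E. e \<noteq> e' \<longrightarrow> 0 \<le> dt e e')"

definition supp :: "(rat \<Rightarrow> 'v \<Rightarrow> 'v::ab_group_add) \<Rightarrow> 'v set \<Rightarrow> 'v \<Rightarrow> 'v set" where
  "supp scale E v = {e. module.representation scale E v e \<noteq> 0}"

definition support_space :: "(rat \<Rightarrow> 'v \<Rightarrow> 'v::ab_group_add) \<Rightarrow> 'v set \<Rightarrow> 'v \<Rightarrow> 'v set" where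
  "support_space scale E v = module.span scale (supp scale E v)"

definition effective :: "(rat \<Rightarrow> 'v \<Rightarrow> 'v::ab_group_add) \<Rightarrow> 'v set \<Rightarrow> 'v \<Rightarrow> bool" where
  "effective scale E v \<longleftrightarrow> (\<forall>e\<in>supp scale E v. 0 < module.representation scale E v e)"

definition nef ::
    "(rat \<Rightarrow> 'v \<Rightarrow> 'v::ab_group_add) \<Rightarrow> 'v set \<Rightarrow> ('v \<Rightarrow> 'v \<Rightarrow> rat) \<Rightarrow> 'v \<Rightarrow> bool" where
  "nef scale E dt w \<longleftrightarrow> (\<forall>v. effective scale E v \<longrightarrow> 0 \<le> dt w v)"

definition negative_definite_on :: "('v::zero \<Rightarrow> 'v \<Rightarrow> rat) \<Rightarrow> 'v set \<Rightarrow> bool" where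
  "negative_definite_on dt S \<longleftrightarrow> (\<forall>x\<in>S. x \<noteq> 0 \<longrightarrow> dt x x < 0)"

definition zariski_decomposition ::
    "(rat \<Rightarrow> 'v \<Rightarrow> 'v::ab_group_add) \<Rightarrow> 'v set \<Rightarrow> ('v \<Rightarrow> 'v \<Rightarrow> rat) \<Rightarrow> 'v \<Rightarrow> 'v \<Rightarrow> 'v \<Rightarrow> bool" where
  "zariski_decomposition scale E dt v p n \<longleftrightarrow>
     v = p + n \<and>
     nef scale E dt p \<and>
     effective scale E n \<and>
     (\<forall>e\<in>supp scale E n. dt p e = 0) \<and>
     negative_definite_on dt (support_space scale E n)"

end

theory Submission
  imports Defs
begin

text \<open>
  Everything rests on one positivity principle (\<open>effective_if_nonpos\<close>): if the form is
  negative definite on the span of \<open>A \<subseteq> E\<close>, and \<open>x\<close> has nonpositive product with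
  each element of \<open>A\<close> and nonnegative coordinates outside \<open>A\<close>, then \<open>x\<close> is
  effective. Write \<open>x\<close> as the difference of its positive and negative parts; the two have
  disjoint supports, so their product is nonnegative, and if the negative part \<open>m\<close> were not
  zero, then \<open>x \<cdot> m\<close> would be positive, against the sign assumption.

  The principle gives at once that \<open>p\<close> is effective (take \<open>x = p\<close> and the support
  of \<open>n\<close> for \<open>A\<close>). It also gives uniqueness: for two decompositions with negative
  parts \<open>n\<close> and \<open>n'\<close>, take \<open>x = n' - n\<close> and the support of \<open>n\<close>
  for \<open>A\<close> to see that \<open>n' - n\<close> is effective, then exchange the roles.

  For existence, compactness arguments fail over the rationals; the proof is algebraic instead.
  Consider the subsets \<open>A\<close> of the support of \<open>v\<close>, with the form negative definite
  on their span, for which \<open>v\<close> is the sum of an effective \<open>p\<close> orthogonal to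
  \<open>A\<close> and an effective vector supported in \<open>A\<close>; only nefness is missing
  (\<open>partial_decomposition\<close>). The empty set is one of them, and they are finitely many, so
  there is a maximal one. If its \<open>p\<close> were not nef, then \<open>p \<cdot> e < 0\<close> for some
  \<open>e \<in> E\<close>. Let \<open>f\<close> be the vector congruent to \<open>e\<close> modulo the span of
  \<open>A\<close> and orthogonal to \<open>A\<close>. It is effective by the principle, satisfies
  \<open>f \<cdot> f < 0\<close> because \<open>p \<cdot> f < 0\<close> and \<open>p\<close> is effective, and moving
  a positive multiple of \<open>f\<close> from \<open>p\<close> to the negative part makes \<open>p\<close>
  orthogonal to \<open>e\<close> as well. This enlarges \<open>A\<close> (\<open>partial_decomposition_extend\<close>),
  a contradiction.
\<close>

locale intersection_form = vector_space scale
  for scale :: "rat \<Rightarrow> 'v \<Rightarrow> 'v::ab_group_add" +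
  fixes E :: "'v set" and dt :: "'v \<Rightarrow> 'v \<Rightarrow> rat"
  assumes basis: "is_basis scale E"
    and form: "symmetric_bilinear scale dt"
    and inter: "intersection_product E dt"
begin

section \<open>Coordinates and bilinearity\<close>

abbreviation coord :: "'v \<Rightarrow> 'v \<Rightarrow> rat" where
  "coord \<equiv> representation E"

lemma indep: "independent E" and in_span [simp]: "x \<in> span E"
  using basis by (auto simp: is_basis_def)

lemma dt_sym: "dt x y = dt y x"
  using form by (auto simp: symmetric_bilinear_def)

lemma linear_dt: "Vector_Spaces.linear scale (*) (dt x)"
  using form by (auto simp: symmetric_bilinear_def)

lemma dt_add_right: "dt x (y + z) = dt x y + dt x z"
  and dt_diff_right: "dt x (y - z) = dt x y - dt x z"
  and dt_scale_right: "dt x (scale c y) = c * dt x y"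
  and dt_sum_right: "dt x (sum g S) = (\<Sum>i\<in>S. dt x (g i))"
  and dt_zero_right: "dt x 0 = 0"
  using linear_dt[of x]
  by (simp_all add: linear_iff_module_hom module_hom.add module_hom.diff module_hom.scale
      module_hom.sum module_hom.zero)

lemma dt_add_left: "dt (y + z) x = dt y x + dt z x"
  and dt_diff_left: "dt (y - z) x = dt y x - dt z x"
  and dt_scale_left: "dt (scale c y) x = c * dt y x"
  and dt_zero_left: "dt 0 x = 0"
  using dt_add_right dt_diff_right dt_scale_right dt_zero_right dt_sym by metis+

lemmas dt_bilinear = dt_add_left dt_add_right dt_diff_left dt_diff_right
  dt_scale_left dt_scale_right

lemma coord_add [simp]: "coord (x + y) b = coord x b + coord y b"
  and coord_diff [simp]: "coord (x - y) b = coord x b - coord y b"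
  and coord_scale [simp]: "coord (scale c x) b = c * coord x b"
  using indep by (simp_all add: representation_add representation_diff representation_scale)

lemma coord_basis: "e \<in> E \<Longrightarrow> coord e b = (if b = e then 1 else 0)"
  using indep by (auto simp: representation_basis)

lemma supp_subset_basis: "supp scale E x \<subseteq> E"
  by (auto simp: supp_def dest: representation_ne_zero)

lemma finite_supp: "finite (supp scale E x)"
  by (simp add: supp_def finite_representation)

lemma sum_coord: "(\<Sum>b\<in>supp scale E x. scale (coord x b) b) = x"
  using indep by (simp add: supp_def sum_nonzero_representation_eq)

lemma coord_eqI:
  assumes "\<And>b. coord x b = coord y b" shows "x = y"
proof -
  have "supp scale E x = supp scale E y" using assms by (simp add: supp_def)
  then have "(\<Sum>b\<in>supp scale E x. scale (coord x b) b) =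
      (\<Sum>b\<in>supp scale E y. scale (coord y b) b)"
    by (rule sum.cong) (simp add: assms)
  then show ?thesis by (simp only: sum_coord)
qed

lemma effective_iff: "effective scale E x \<longleftrightarrow> (\<forall>b. 0 \<le> coord x b)"
proof -
  have "(c \<noteq> 0 \<longrightarrow> 0 < c) \<longleftrightarrow> 0 \<le> c" for c :: rat by auto
  then show ?thesis by (simp add: effective_def supp_def)
qed

lemma coord_outside:
  assumes "A \<subseteq> E" "x \<in> span A" "b \<notin> A" shows "coord x b = 0"
proof -
  have "coord x b = representation A x b"
    by (simp only: representation_extend[OF indep assms(2,1)])
  also have "\<dots> = 0"
    using representation_ne_zero[of A x b] assms(3) by blast
  finally show ?thesis .
qed

lemma in_span_if_coord:
  assumes "\<And>b. b \<notin> A \<Longrightarrow> coord x b = 0" shows "x \<in> span A"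
proof -
  have "(\<Sum>b\<in>supp scale E x. scale (coord x b) b) \<in> span A"
    by (rule span_sum, rule span_scale, rule span_base) (use assms in \<open>auto simp: supp_def\<close>)
  then show ?thesis by (simp add: sum_coord)
qed

lemma dt_nonneg_coordwise:
  assumes "\<And>b. b \<in> E \<Longrightarrow> 0 \<le> coord x b * dt y b"
  shows "0 \<le> dt y x"
proof -
  have "dt y x = (\<Sum>b\<in>supp scale E x. coord x b * dt y b)"
    using sum_coord[of x] by (metis (no_types, lifting) dt_sum_right dt_scale_right sum.cong)
  also have "\<dots> \<ge> 0"
    using assms supp_subset_basis by (intro sum_nonneg) auto
  finally show ?thesis .
qed

lemma dt_basis_nonneg:
  assumes "effective scale E x" "e \<in> E" "coord x e = 0"
  shows "0 \<le> dt x e"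
proof -
  have "0 \<le> coord x b * dt e b" if "b \<in> E" for b
    using assms inter that by (cases "b = e") (auto simp: effective_iff intersection_product_def)
  then have "0 \<le> dt e x" by (rule dt_nonneg_coordwise)
  then show ?thesis by (simp add: dt_sym)
qed

lemma nef_iff: "nef scale E dt p \<longleftrightarrow> (\<forall>e\<in>E. 0 \<le> dt p e)"
proof
  show "\<forall>e\<in>E. 0 \<le> dt p e" if "nef scale E dt p"
    using that by (auto simp: nef_def effective_iff coord_basis)
  show "nef scale E dt p" if "\<forall>e\<in>E. 0 \<le> dt p e"
    using that unfolding nef_def effective_iff
    by (intro allI impI dt_nonneg_coordwise) simp
qed

lemma dt_nonneg_disjoint:
  assumes "effective scale E x" "effective scale E y"
    and disj: "\<And>b. coord x b = 0 \<or> coord y b = 0"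
  shows "0 \<le> dt x y"
proof (rule dt_nonneg_coordwise)
  fix b assume "b \<in> E"
  then show "0 \<le> coord y b * dt x b"
    using disj[of b] assms(1,2) dt_basis_nonneg[of x b]
    by (cases "coord y b = 0") (auto simp: effective_iff)
qed

lemma negative_part_exists: "\<exists>m. \<forall>b. coord m b = max 0 (- coord x b)"
proof -
  let ?S = "supp scale E x"
  let ?m = "\<Sum>b\<in>?S. scale (max 0 (- coord x b)) b"
  have "coord ?m b = max 0 (- coord x b)" for b
  proof -
    have "coord ?m b = (\<Sum>c\<in>?S. coord (scale (max 0 (- coord x c)) c) b)"
      using indep by (simp add: representation_sum)
    also have "\<dots> = (\<Sum>c\<in>?S. if c = b then max 0 (- coord x c) else 0)"
      using supp_subset_basis by (intro sum.cong) (auto simp: coord_basis subset_iff)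
    also have "\<dots> = (if b \<in> ?S then max 0 (- coord x b) else 0)"
      using finite_supp by (simp add: sum.delta)
    also have "\<dots> = max 0 (- coord x b)" by (simp add: supp_def)
    finally show ?thesis .
  qed
  then show ?thesis by blast
qed

section \<open>The positivity principle and uniqueness\<close>

text \<open>
  The negative part \<open>m\<close> of \<open>x\<close> lies in the span of \<open>A\<close>, so
  \<open>x \<cdot> m \<le> 0\<close>. Since \<open>x + m\<close> and \<open>m\<close> are effective with disjoint
  supports, \<open>m \<cdot> m = (x + m) \<cdot> m - x \<cdot> m \<ge> 0\<close>, and negative definiteness forces
  \<open>m = 0\<close>.
\<close>
lemma effective_if_nonpos:
  assumes nd: "negative_definite_on dt (span A)"
    and nonpos: "\<And>a. a \<in> A \<Longrightarrow> dt x a \<le> 0"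
    and outside: "\<And>b. b \<notin> A \<Longrightarrow> 0 \<le> coord x b"
  shows "effective scale E x"
proof -
  obtain m where m: "\<And>b. coord m b = max 0 (- coord x b)"
    using negative_part_exists[of x] by blast
  have "0 \<le> dt (- x) m"
  proof (rule dt_nonneg_coordwise)
    fix b
    show "0 \<le> coord m b * dt (- x) b"
      using outside[of b] nonpos[of b] dt_diff_left[of 0 x b]
      by (cases "b \<in> A") (auto simp: m dt_zero_left intro!: mult_nonneg_nonpos)
  qed
  then have xm: "dt x m \<le> 0" using dt_diff_left[of 0 x m] by (simp add: dt_zero_left)
  have "0 \<le> dt (x + m) m"
    by (rule dt_nonneg_disjoint) (auto simp: effective_iff m max_def)
  with xm have "0 \<le> dt m m" by (simp add: dt_add_left)
  moreover have "m \<in> span A"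
    using outside by (intro in_span_if_coord) (simp add: m)
  ultimately have "m = 0"
    using nd unfolding negative_definite_on_def by force
  then have "0 \<le> coord x b" for b
    using m[of b] by (simp add: representation_zero max_def split: if_splits)
  then show ?thesis by (simp add: effective_iff)
qed

lemma zariski_effective:
  assumes "effective scale E v" and z: "zariski_decomposition scale E dt v p n"
  shows "effective scale E p"
proof (rule effective_if_nonpos)
  show "negative_definite_on dt (span (supp scale E n))"
    using z by (simp add: zariski_decomposition_def support_space_def)
  show "dt p a \<le> 0" if "a \<in> supp scale E n" for a
    using z that by (simp add: zariski_decomposition_def)
  show "0 \<le> coord p b" if "b \<notin> supp scale E n" for b
  proof -
    have "coord v b = coord p b + coord n b"
      using z by (simp add: zariski_decomposition_def)
    moreover have "0 \<le> coord v b" using assms(1) by (simp add: effective_iff)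
    ultimately show ?thesis using that by (simp add: supp_def)
  qed
qed

text \<open>
  The difference equals \<open>p - p'\<close>, whose product with each element of the support of
  \<open>n\<close> is \<open>- p' \<cdot> a \<le> 0\<close>; outside that support its coordinates are those of
  \<open>n'\<close>. Hence the negative part is least among all decompositions, in the coordinatewise
  order.
\<close>
lemma zariski_negative_part_least:
  assumes z: "zariski_decomposition scale E dt v p n"
    and z': "zariski_decomposition scale E dt v p' n'"
  shows "effective scale E (n' - n)"
proof (rule effective_if_nonpos)
  have eq: "n' - n = p - p'"
    using z z' by (simp add: zariski_decomposition_def algebra_simps)
  show "negative_definite_on dt (span (supp scale E n))"
    using z by (simp add: zariski_decomposition_def support_space_def)
  show "dt (n' - n) a \<le> 0" if "a \<in> supp scale E n" for a
    using z z' that supp_subset_basis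
    by (auto simp: eq dt_diff_left zariski_decomposition_def nef_iff)
  show "0 \<le> coord (n' - n) b" if "b \<notin> supp scale E n" for b
    using z' that by (simp add: supp_def effective_iff zariski_decomposition_def)
qed

lemma zariski_unique:
  assumes z: "zariski_decomposition scale E dt v p n"
    and z': "zariski_decomposition scale E dt v p' n'"
  shows "p = p' \<and> n = n'"
proof -
  have "n = n'"
    using zariski_negative_part_least[OF z z'] zariski_negative_part_least[OF z' z]
    by (intro coord_eqI order.antisym) (simp_all add: effective_iff)
  then show ?thesis using z z' by (simp add: zariski_decomposition_def)
qed

section \<open>Orthogonal projection and existence\<close>

lemma dt_span_zero:
  assumes "\<And>a. a \<in> A \<Longrightarrow> dt x a = 0" "y \<in> span A"
  shows "dt x y = 0"
  using assms(2)
  by (induction rule: span_induct_alt) (simp_all add: dt_zero_right dt_bilinear assms(1))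

text \<open>
  This is the Gram-Schmidt process. Its only division is by \<open>b' \<cdot> b'\<close>, where \<open>b'\<close>
  is the new element made orthogonal to the earlier ones. If this product is zero, then so is
  \<open>b'\<close>, by definiteness, and no correction is needed; division by zero yields zero, so
  the same formula covers that case.
\<close>
lemma orthogonal_projection:
  assumes "finite A" "negative_definite_on dt (span A)"
  shows "\<exists>z\<in>span A. \<forall>a\<in>A. dt (u + z) a = 0"
  using assms
proof (induction A arbitrary: u rule: finite_induct)
  case empty
  then show ?case by auto
next
  case (insert b A)
  have sub: "span A \<subseteq> span (insert b A)" by (intro span_mono) auto
  then have nd: "negative_definite_on dt (span A)"
    using insert.prems by (auto simp: negative_definite_on_def)
  obtain z where z: "z \<in> span A" "\<And>a. a \<in> A \<Longrightarrow> dt (u + z) a = 0"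
    using insert.IH[OF nd, of u] by blast
  obtain y where y: "y \<in> span A" "\<And>a. a \<in> A \<Longrightarrow> dt (b + y) a = 0"
    using insert.IH[OF nd, of b] by blast
  define b' where "b' = b + y"
  define c where "c = dt (u + z) b' / dt b' b'"
  define w where "w = z - scale c b'"
  have b': "b' \<in> span (insert b A)"
    unfolding b'_def by (rule span_add[OF span_base]) (use y(1) sub in auto)
  have uw: "dt (u + w) x = dt (u + z) x - c * dt b' x" for x
    by (simp add: w_def dt_bilinear)
  have orth: "dt (u + w) a = 0" if "a \<in> A" for a
    using z(2) y(2) that unfolding uw b'_def by simp
  have "dt b' b' \<noteq> 0 \<or> b' = 0"
    using b' insert.prems unfolding negative_definite_on_def by force
  then have "dt (u + w) b' = 0"
    unfolding uw by (auto simp: c_def dt_zero_right)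
  moreover have "dt (u + w) y = 0" by (rule dt_span_zero[OF orth y(1)])
  ultimately have "dt (u + w) b = 0" by (simp add: b'_def dt_add_right)
  moreover have "w \<in> span (insert b A)"
    using z b' sub by (auto simp: w_def intro!: span_diff[OF _ span_scale])
  ultimately show ?case using orth by blast
qed

definition partial_decomposition :: "'v \<Rightarrow> 'v set \<Rightarrow> 'v \<Rightarrow> bool" where
  "partial_decomposition v A n \<longleftrightarrow>
     A \<subseteq> supp scale E v \<and> n \<in> span A \<and> negative_definite_on dt (span A) \<and>
     effective scale E n \<and> effective scale E (v - n) \<and> (\<forall>a\<in>A. dt (v - n) a = 0)"

text \<open>
  Negative definiteness survives the enlargement because the span of \<open>insert e A\<close> is the
  orthogonal sum of the span of \<open>A\<close> and the line through \<open>f\<close>, the part of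
  \<open>e\<close> orthogonal to \<open>A\<close>, and \<open>f \<cdot> f < 0\<close>. The last inequality comes
  from comparing \<open>p\<close> with \<open>c f\<close>, where \<open>c > 0\<close> is the coordinate of
  \<open>p\<close> at \<open>e\<close>: the difference has no \<open>e\<close>-coordinate, its \<open>A\<close>-part
  is orthogonal to \<open>f\<close>, and the remaining part is effective with support disjoint from
  that of \<open>f\<close>. Hence \<open>c (f \<cdot> f) \<le> p \<cdot> f = p \<cdot> e < 0\<close>.
\<close>
lemma partial_decomposition_extend:
  assumes part: "partial_decomposition v A n"
    and e: "e \<in> E" and neg: "dt (v - n) e < 0"
  shows "e \<notin> A \<and> (\<exists>n'. partial_decomposition v (insert e A) n')"
proof -
  define p where "p = v - n"
  have A: "A \<subseteq> supp scale E v" and n: "n \<in> span A" "effective scale E n"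
    and nd: "negative_definite_on dt (span A)" and p: "effective scale E p"
    and pA: "\<And>a. a \<in> A \<Longrightarrow> dt p a = 0" and pe: "dt p e < 0"
    using part neg by (auto simp: partial_decomposition_def p_def)
  have AE: "A \<subseteq> E" using A supp_subset_basis by blast
  have eA: "e \<notin> A" using pA pe by force
  have c: "0 < coord p e"
    using dt_basis_nonneg[OF p e] pe p by (force simp: effective_iff less_le)
  then have ev: "e \<in> supp scale E v"
    using coord_outside[OF AE n(1) eA] by (simp add: p_def supp_def)

  obtain z where z: "z \<in> span A" and orth: "\<And>a. a \<in> A \<Longrightarrow> dt (e + z) a = 0"
    using orthogonal_projection[OF finite_subset[OF A finite_supp] nd, of e] by blast
  define f where "f = e + z"
  have fA: "\<And>a. a \<in> A \<Longrightarrow> dt f a = 0" using orth by (simp add: f_def)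
  have f_outside: "coord f b = (if b = e then 1 else 0)" if "b \<notin> A" for b
    using that coord_outside[OF AE z] by (simp add: f_def coord_basis[OF e])
  have f: "effective scale E f"
    by (rule effective_if_nonpos[OF nd]) (simp_all add: fA f_outside)
  have f_span: "f \<in> span (insert e A)"
    unfolding f_def
    by (rule span_add[OF span_base]) (use z span_mono[of A "insert e A"] in auto)
  have pf: "dt p f = dt p e"
    using dt_span_zero[OF pA z] by (simp add: f_def dt_add_right)
  have ff: "dt f f = dt f e"
    using dt_span_zero[OF fA z] by (simp add: f_def dt_add_right)

  have "0 \<le> dt f (p - scale (coord p e) f)"
  proof (rule dt_nonneg_coordwise)
    fix b assume b: "b \<in> E"
    consider "b \<in> A" | "b = e" | "b \<notin> A" "b \<noteq> e" by blast
    then show "0 \<le> coord (p - scale (coord p e) f) b * dt f b"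
    proof cases
      case 1
      then show ?thesis by (simp add: fA)
    next
      case 2
      then show ?thesis by (simp add: f_outside[OF eA])
    next
      case 3
      then show ?thesis
        using p dt_basis_nonneg[OF f b] by (simp add: f_outside effective_iff)
    qed
  qed
  then have "coord p e * dt f f < 0"
    using pe pf dt_sym[of f p] by (simp add: dt_bilinear)
  with c have ff_neg: "dt f f < 0" by (simp add: mult_less_0_iff)

  have nd': "negative_definite_on dt (span (insert e A))"
    unfolding negative_definite_on_def
  proof (intro ballI impI)
    fix x assume "x \<in> span (insert e A)" "x \<noteq> 0"
    then obtain t where "x - scale t e \<in> span A" by (auto simp: span_insert)
    then have "(x - scale t e) - scale t z \<in> span A"
      by (rule span_diff[OF _ span_scale[OF z]])
    then have y: "x - scale t f \<in> span A" (is "?y \<in> _")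
      by (simp add: f_def scale_right_distrib diff_diff_eq)
    have "dt f ?y = 0" by (rule dt_span_zero[OF fA y])
    then have xx: "dt x x = dt ?y ?y + t * t * dt f f"
      using dt_sym[of f x] by (simp add: dt_bilinear algebra_simps)
    show "dt x x < 0"
    proof (cases "?y = 0")
      case True
      then have "t \<noteq> 0" using \<open>x \<noteq> 0\<close> by auto
      then have "t * t * dt f f < 0"
        using ff_neg by (intro mult_pos_neg) (auto simp: zero_less_mult_iff)
      then show ?thesis unfolding xx True by (simp add: dt_zero_left)
    next
      case False
      then have "dt ?y ?y < 0" using nd y by (simp add: negative_definite_on_def)
      moreover have "t * t * dt f f \<le> 0" using ff_neg by (intro mult_nonneg_nonpos) auto
      ultimately show ?thesis unfolding xx by linarith
    qed
  qed

  \<comment> \<open>The multiple of \<open>f\<close> whose removal makes the positive part orthogonal to \<open>e\<close>.\<close>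
  define s where "s = dt p e / dt f f"
  define n' where "n' = n + scale s f"
  have s: "0 < s" using pe ff_neg by (simp add: s_def divide_neg_neg)
  have p': "v - n' = p - scale s f" by (simp add: n'_def p_def algebra_simps)
  have orth': "dt (v - n') a = 0" if "a \<in> insert e A" for a
    using that ff ff_neg pA fA unfolding p' by (auto simp: dt_bilinear s_def)
  have "effective scale E (v - n')"
  proof (rule effective_if_nonpos[OF nd'])
    show "dt (v - n') a \<le> 0" if "a \<in> insert e A" for a using orth'[OF that] by simp
    show "0 \<le> coord (v - n') b" if "b \<notin> insert e A" for b
      using that p unfolding p' by (simp add: f_outside effective_iff)
  qed
  moreover have "effective scale E n'"
    using n(2) f s by (simp add: n'_def effective_iff)
  moreover have "n' \<in> span (insert e A)"
    using n(1) f_span span_mono[of A "insert e A"]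
    by (auto simp: n'_def intro!: span_add[OF _ span_scale])
  ultimately have "partial_decomposition v (insert e A) n'"
    using A ev nd' orth' by (auto simp: partial_decomposition_def)
  with eA show ?thesis by blast
qed

lemma zariski_exists:
  assumes v: "effective scale E v"
  shows "\<exists>p n. zariski_decomposition scale E dt v p n"
proof -
  let ?F = "{A. \<exists>n. partial_decomposition v A n}"
  have "finite ?F"
    by (rule finite_subset[of _ "Pow (supp scale E v)"])
      (auto simp: partial_decomposition_def finite_supp)
  moreover have "partial_decomposition v {} 0"
    using v by (auto simp: partial_decomposition_def negative_definite_on_def effective_iff
        representation_zero)
  then have "?F \<noteq> {}" by blast
  ultimately obtain A where "A \<in> ?F" and max: "\<forall>B\<in>?F. A \<subseteq> B \<longrightarrow> A = B"
    using finite_has_maximal[of ?F] by blast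
  then obtain n where n: "partial_decomposition v A n" by blast
  have "0 \<le> dt (v - n) e" if "e \<in> E" for e
    using partial_decomposition_extend[OF n that] max by (force simp: not_less[symmetric])
  moreover have "supp scale E n \<subseteq> A"
    using n coord_outside[of A n] supp_subset_basis[of v]
    by (auto simp: partial_decomposition_def supp_def)
  ultimately have "zariski_decomposition scale E dt v (v - n) n"
    using n span_mono[of "supp scale E n" A]
    by (auto simp: partial_decomposition_def zariski_decomposition_def nef_iff
        negative_definite_on_def support_space_def subset_iff)
  then show ?thesis by blast
qed

end

theorem theorem3p3:
  fixes scale :: "rat \<Rightarrow> 'v \<Rightarrow> 'v::ab_group_add"
    and E :: "'v set"
    and dt :: "'v \<Rightarrow> 'v \<Rightarrow> rat"
    and v :: 'v
  assumes "vector_space scale"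
    and "is_basis scale E"
    and "symmetric_bilinear scale dt"
    and "intersection_product E dt"
    and "effective scale E v"
  shows "(\<exists>!pn. zariski_decomposition scale E dt v (fst pn) (snd pn)) \<and>
         (\<forall>p n. zariski_decomposition scale E dt v p n \<longrightarrow> effective scale E p)"
proof -
  interpret intersection_form scale E dt
    using assms by (simp add: intersection_form_def intersection_form_axioms_def)
  obtain p n where z: "zariski_decomposition scale E dt v p n"
    using zariski_exists[OF assms(5)] by blast
  have "\<exists>!pn. zariski_decomposition scale E dt v (fst pn) (snd pn)"
    by (rule ex1I[of _ "(p, n)"]) (use z zariski_unique in \<open>auto simp: prod_eq_iff\<close>)
  then show ?thesis using zariski_effective[OF assms(5)] by blast
qed

end
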